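(* The equation $$y^2 - xyz + z^2 = x^3 - 5$$ has no integer solution; that is, there are no integers $x, y, z \in \mathbb{Z}$ satisfying it. *)

theory Defs
  imports Main
begin

end

theory Submission
  imports Defs
begin

text \<open>
  The equation reads (y - z)^2 - 3 = (x - 2) (y z + x^2 + 2 x + 4), so x - 2 divides a number of the
  form u^2 - 3. An odd divisor of such a number that is prime to 3 is congruent to 1 or -1 modulo 12.
  On the other hand, the equation modulo 4 and modulo 9 forces x - 2 to be 7 modulo 12, or to be
  3 k with k congruent to 5 modulo 12.
\<close>

text \<open>
  A descent replaces quadratic reciprocity: with u even and |u| < |n|, the cofactor of n in
  u^2 - 3 (divided by 3 if 3 divides u) is a smaller divisor of the same kind.
\<close>

lemma divisor_square_minus_3_mod_12:
  fixes n u :: int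
  assumes "odd n" "\<not> 3 dvd n" "n dvd u^2 - 3"
  shows "n mod 12 = 1 \<or> n mod 12 = 11"
  using assms
proof (induction "nat \<bar>n\<bar>" arbitrary: n u rule: less_induct)
  case less
  define N where "N = \<bar>n\<bar>"
  have N: "odd N" "\<not> 3 dvd N" "N dvd u^2 - 3" "N > 0"
    using less.prems by (auto simp: N_def)
  \<comment> \<open>A change of sign swaps 1 and 11 modulo 12, so the argument may work with the
    positive \<open>N\<close>.\<close>
  have sufficient: ?case if "N mod 12 = 1 \<or> N mod 12 = 11"
  proof -
    have "n = N \<or> n = - N" by (auto simp: N_def)
    then show ?thesis using that by (elim disjE) (simp, presburger)+
  qed
  show ?case
  proof (cases "N = 1")
    case True
    then show ?thesis by (intro sufficient) simp
  next
    case False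
    then have N5: "N \<ge> 5"
      using N(1,2,4) by presburger
    \<comment> \<open>As \<open>N\<close> is odd, \<open>u mod N\<close> and
      \<open>u mod N - N\<close> have opposite parity, so one of them is even. Evenness of
      \<open>w\<close> makes the cofactor odd and fixes \<open>w^2 - 3\<close> modulo 4.\<close>
    define w where "w = (if even (u mod N) then u mod N else u mod N - N)"
    have r: "0 \<le> u mod N" "u mod N < N" using N by auto
    have "even w" using N by (auto simp: w_def)
    \<comment> \<open>This excludes \<open>w = - N\<close>, so that the bound on \<open>w\<close> is
      strict.\<close>
    have "u mod N \<noteq> 0" if "odd (u mod N)" using that by auto
    then have w_less: "\<bar>w\<bar> < N"
      using r by (auto simp: w_def abs_less_iff)
    have "w mod N = u mod N" by (simp add: w_def)
    then have "(w^2 - 3) mod N = (u^2 - 3) mod N"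
      by (metis mod_diff_left_eq power_mod)
    then have "N dvd w^2 - 3"
      using N by (simp add: dvd_eq_mod_eq_0)
    then obtain m where m: "w^2 - 3 = N * m" by (elim dvdE)
    have m_less: "\<bar>m\<bar> < N"
    proof -
      have "w^2 < N^2"
        using power_strict_mono[OF w_less, of 2] by simp
      moreover have "N^2 \<ge> 5 * N" using N5 by (simp add: power2_eq_square)
      moreover have "w^2 \<ge> 0" by simp
      ultimately have "\<bar>w^2 - 3\<bar> < N^2" using N5 by linarith
      then have "N * \<bar>m\<bar> < N * N"
        using N(4) unfolding m abs_mult power2_eq_square[of N] by simp
      then show ?thesis using N by simp
    qed
    obtain v where v: "w = 2 * v" using \<open>even w\<close> by (elim evenE)
    have Nm: "N * m = 4 * v^2 - 3"
      using m by (simp add: v power_mult_distrib)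
    have "odd (N * m)" by (simp add: Nm)
    then have "odd m" by simp
    have inverse: "N mod 12 = 1 \<or> N mod 12 = 11"
      if "(N * k) mod 12 = 1 \<or> (N * k) mod 12 = 11" "k mod 12 = 1 \<or> k mod 12 = 11" for k
    proof -
      have prod: "(N * (k mod 12)) mod 12 = 1 \<or> (N * (k mod 12)) mod 12 = 11"
        using that(1) by (simp add: mod_mult_right_eq)
      from that(2) show ?thesis
      proof
        assume "k mod 12 = 1"
        then show ?thesis using prod by simp
      next
        assume "k mod 12 = 11"
        then have "(N * 11) mod 12 = 1 \<or> (N * 11) mod 12 = 11" using prod by simp
        \<comment> \<open>Here 11 is its own inverse modulo 12: 11 * 11 = 121 = 1 + 12 * 10.\<close>
        moreover have "N mod 12 = (N + 12 * (10 * N)) mod 12" by (rule mod_mult_self2[symmetric])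
        then have "N mod 12 = ((N * 11) mod 12 * 11) mod 12" by (simp only: mod_mult_left_eq) simp
        ultimately show ?thesis by (elim disjE) simp_all
      qed
    qed
    show ?thesis
    proof (cases "3 dvd v")
      case True
      then obtain t where t: "v = 3 * t" by (elim dvdE)
      have "3 dvd N * m" unfolding Nm t by (simp add: power_mult_distrib)
      then have "((N mod 3) * m) mod 3 = 0" by (simp add: mod_mult_left_eq)
      moreover have "N mod 3 = 1 \<or> N mod 3 = 2" using N(2) by presburger
      ultimately have "m mod 3 = 0 \<or> (2 * m) mod 3 = 0" by auto
      then have "3 dvd m" by presburger
      then obtain k where k: "m = 3 * k" by (elim dvdE)
      \<comment> \<open>Dividing 36 t^2 - 3 by 3 leaves a number that is -1 modulo 12, hence prime
        to 3. So \<open>k\<close>, unlike \<open>m\<close>, satisfies the hypotheses of the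
        induction.\<close>
      have Nk: "N * k = 12 * t^2 - 1"
        using Nm unfolding t k by (simp add: power_mult_distrib)
      have "(N * k) mod 12 = 11" unfolding Nk by presburger
      moreover have "\<not> 3 dvd N * k" unfolding Nk by presburger
      then have "k mod 12 = 1 \<or> k mod 12 = 11"
        using m_less \<open>odd m\<close> m k N by (intro less.hyps[of k w]) (auto simp: N_def)
      ultimately show ?thesis using inverse sufficient by blast
    next
      case False
      \<comment> \<open>With v^2 congruent to 1 modulo 3, 4 v^2 - 3 is congruent to 4 - 3 = 1 modulo
        12.\<close>
      then have "v^2 mod 3 = 1"
      proof -
        have "v mod 3 = 1 \<or> v mod 3 = 2" using False by presburger
        then show ?thesis using power_mod[of v 3 2] by (elim disjE) simp_all
      qed
      then have "(N * m) mod 12 = 1" unfolding Nm by presburger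
      moreover from this have "\<not> 3 dvd N * m" by presburger
      then have "m mod 12 = 1 \<or> m mod 12 = 11"
        using m_less \<open>odd m\<close> m by (intro less.hyps[of m w]) (auto simp: N_def)
      ultimately show ?thesis using inverse sufficient by blast
    qed
  qed
qed

theorem theorem1p1:
  shows "\<not> (\<exists>x y z :: int. y^2 - x*y*z + z^2 = x^3 - 5)"
proof
  assume "\<exists>x y z :: int. y^2 - x*y*z + z^2 = x^3 - 5"
  then obtain x y z :: int where eq: "y^2 - x*y*z + z^2 = x^3 - 5" by blast
  \<comment> \<open>Subtracting 3 turns the constant 5 into 8, and both x^3 - 8 and (x - 2) y z are
    multiples of x - 2.\<close>
  have "(y - z)^2 - 3 = (x - 2) * (y*z + x^2 + 2*x + 4)"
    using eq by (simp add: algebra_simps power2_eq_square power3_eq_cube)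
  then have dvd: "x - 2 dvd (y - z)^2 - 3" by simp
  have residues: "((y mod m)^2 - (x mod m) * (y mod m) * (z mod m) + (z mod m)^2) mod m
      = ((x mod m)^3 - 5) mod m" for m
  proof -
    have "((y mod m)^2 - (x mod m) * (y mod m) * (z mod m) + (z mod m)^2) mod m
        = (y^2 - x*y*z + z^2) mod m"
      unfolding power2_eq_square by (intro mod_add_cong mod_diff_cong mod_mult_cong mod_mod_trivial)
    also have "\<dots> = (x^3 - 5) mod m" by (simp add: eq)
    also have "\<dots> = ((x mod m)^3 - 5) mod m"
      unfolding power3_eq_cube by (intro mod_diff_cong mod_mult_cong mod_mod_trivial[symmetric] refl)
    finally show ?thesis .
  qed
  have cases4: "t mod 4 = 0 \<or> t mod 4 = 1 \<or> t mod 4 = 2 \<or> t mod 4 = 3" for t :: int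
    by presburger
  have x4: "x mod 4 = 1"
    using residues[of 4] cases4[of x] cases4[of y] cases4[of z] by (elim disjE) simp_all
  have cases3: "t mod 3 = 0 \<or> t mod 3 = 1 \<or> t mod 3 = 2" for t :: int
    by presburger
  \<comment> \<open>For x congruent to 1, the left side becomes (y + z)^2 modulo 3 and the right
    side 2, a non-square.\<close>
  have x3: "x mod 3 \<noteq> 1"
    using residues[of 3] cases3[of y] cases3[of z] by (elim disjE) (auto)
  have cases9: "t mod 9 = 0 \<or> t mod 9 = 1 \<or> t mod 9 = 2 \<or> t mod 9 = 3 \<or> t mod 9 = 4
      \<or> t mod 9 = 5 \<or> t mod 9 = 6 \<or> t mod 9 = 7 \<or> t mod 9 = 8" for t :: int
    by presburger
  \<comment> \<open>If x is 2 modulo 9, then (y - z)^2 would be 3 modulo 9. If x is 5, the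
    factorization forces y and z to agree modulo 3 and y z to be -1 modulo 3, again a
    non-square.\<close>
  have x9: "x mod 9 \<noteq> 2 \<and> x mod 9 \<noteq> 5"
    using residues[of 9] cases9[of y] cases9[of z] by (elim disjE) auto
  show False
  proof (cases "x mod 3 = 0")
    case True
    then have "(x - 2) mod 12 = 7" using x4 by presburger
    moreover from this have "odd (x - 2)" "\<not> 3 dvd x - 2" by presburger+
    ultimately show False
      using divisor_square_minus_3_mod_12[OF _ _ dvd] by simp
  next
    case False
    then have "3 dvd x - 2" using x3 by presburger
    then obtain k where k: "x - 2 = 3 * k" by (elim dvdE)
    then have x_eq: "x = 3 * k + 2" by simp
    \<comment> \<open>Of the classes 2, 5, 8 modulo 9 only 8 is left for x, so 3 k is 6 modulo
      9.\<close>
    have "k mod 3 = 2" using x9 unfolding x_eq by presburger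
    moreover have "k mod 4 = 1" using x4 unfolding x_eq by presburger
    ultimately have k12: "k mod 12 = 5" by presburger
    then have "odd k" "\<not> 3 dvd k" by presburger+
    moreover have "k dvd (y - z)^2 - 3" using dvd k by (metis dvd_mult_right)
    ultimately show False
      using divisor_square_minus_3_mod_12[of k] k12 by simp
  qed
qed

end
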